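(* Let $\mathcal H$ be a real or complex Hilbert space, let $m\ge1$ be an integer, and let $(U_i)_{1\le i\le m}$ be closed vector subspaces of $\mathcal H$, with orthogonal projectors $(P_i)_{1\le i\le m}$, satisfying the inverse best approximation property. Let $(u_1,\ldots,u_m)\in U_1\times\cdots\times U_m$ and, for every $i\in\{1,\ldots,m-1\}$, set $$T_i\colon U_{i+}\to U_i+U_{i+}\colon v\mapsto(\mathrm{Id}-P_iP_{i+})^{-1}(u_i-P_iv)+(\mathrm{Id}-P_{i+}P_i)^{-1}(v-P_{i+}u_i).$$ Define recursively $\overline{x}_m=u_m$ and, for $i=m-1,\ldots,1$, $\overline{x}_i=T_i\overline{x}_{i+1}$. Then, for every $i\in\{1,\ldots,m\}$, $$\overline{x}_i=P_{S_i}0,\quad\text{where}\quad S_i=\bigcap_{j=i}^m(u_j+U_j^\bot).$$ In particular, $\overline{x}_1$ is the element of minimal norm of $\{x\in\mathcal H : P_ix=u_i\text{ for every }i\in\{1,\ldots,m\}\}$.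
   Context: The family $(U_i)_{1\le i\le m}$ satisfies the inverse best approximation property (IBAP) if for every $(u_1,\ldots,u_m)\in U_1\times\cdots\times U_m$ there exists $x\in\mathcal H$ such that $P_ix=u_i$ for every $i\in\{1,\ldots,m\}$. For $i\in\{0,\ldots,m-1\}$, $U_{i+}=\sum_{j=i+1}^mU_j$ and $P_{i+}$ is the orthogonal projector onto $\overline{U_{i+}}$. For a nonempty closed affine subspace $S$, $P_S$ is the projector onto $S$ (so $P_S0$ is the element of $S$ of minimal norm). Part of the assertion is that the operators $T_i$ are well defined and that each $S_i$ is nonempty. *)

theory Defs
  imports "HOL-Analysis.Analysis"
begin

text \<open>
  The scalar fields \<open>\<real>\<close> and \<open>\<complex>\<close> are treated uniformly. Up to isomorphism they are the only models
  of this class: every \<open>z\<close> is a root of the real polynomial \<open>X^2 - 2 re(z) X + |z|^2\<close>, so the field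
  is algebraic over the reals. On the reals the conjugation is forced to be the identity, on the
  complex numbers it is forced to be the usual one.
\<close>

class real_or_complex = real_normed_field +
  fixes sc_cnj :: "'a \<Rightarrow> 'a" and sc_re :: "'a \<Rightarrow> real"
  assumes sc_cnj_add: "sc_cnj (x + y) = sc_cnj x + sc_cnj y"
    and sc_cnj_mult: "sc_cnj (x * y) = sc_cnj x * sc_cnj y"
    and sc_cnj_cnj: "sc_cnj (sc_cnj x) = x"
    and sc_mult_cnj: "x * sc_cnj x = (norm x)\<^sup>2 *\<^sub>R 1"
    and sc_add_cnj: "x + sc_cnj x = (2 * sc_re x) *\<^sub>R 1"

instantiation real :: real_or_complex
begin

definition sc_cnj_real :: "real \<Rightarrow> real" where "sc_cnj_real x = x"
definition sc_re_real :: "real \<Rightarrow> real" where "sc_re_real x = x"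

instance
  by standard (simp_all add: sc_cnj_real_def sc_re_real_def power2_eq_square)

end

instantiation complex :: real_or_complex
begin

definition sc_cnj_complex :: "complex \<Rightarrow> complex" where "sc_cnj_complex = cnj"
definition sc_re_complex :: "complex \<Rightarrow> real" where "sc_re_complex = Re"

instance
proof
  fix x :: complex
  show "x * sc_cnj x = (norm x)\<^sup>2 *\<^sub>R 1"
    by (simp add: sc_cnj_complex_def complex_norm_square scaleR_conv_of_real del: of_real_power)
qed (simp_all add: sc_cnj_complex_def sc_re_complex_def complex_add_cnj scaleR_conv_of_real)

end

text \<open>
  A Hilbert space over the scalars \<open>'k\<close>. The type \<open>'a\<close> carries the underlying real Hilbert space,
  whose inner product is the real part of \<open>ip\<close>; thus norm, topology and completeness are the ones
  induced by \<open>ip\<close>.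
\<close>

locale hilbert_space = vector_space scale
  for scale :: "'k::real_or_complex \<Rightarrow> 'a::{real_inner,complete_space} \<Rightarrow> 'a" +
  fixes ip :: "'a \<Rightarrow> 'a \<Rightarrow> 'k"
  assumes ip_add_left: "ip (x + y) z = ip x z + ip y z"
    and ip_scale_left: "ip (scale c x) y = c * ip x y"
    and ip_cnj: "ip y x = sc_cnj (ip x y)"
    and inner_eq_re_ip: "inner x y = sc_re (ip x y)"
begin

lemma scaleR_eq_scale: "r *\<^sub>R x = scale (of_real r) x"
proof -
  have re_mult: "sc_re (of_real r * z) = r * sc_re z" for z :: 'k
  proof -
    have c: "sc_cnj (of_real r) = (of_real r :: 'k)"
    proof (cases "r = 0")
      case True
      then show ?thesis using sc_cnj_add[of "0::'k" 0] by simp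
    next
      case False
      have "of_real r * sc_cnj (of_real r) = (of_real r * of_real r :: 'k)"
        by (simp add: sc_mult_cnj power2_eq_square scaleR_conv_of_real)
      with False show ?thesis by simp
    qed
    have "(2 * sc_re (of_real r * z)) *\<^sub>R (1::'k) = of_real r * (z + sc_cnj z)"
      by (simp only: sc_add_cnj[symmetric] sc_cnj_mult c distrib_left)
    also have "\<dots> = (2 * (r * sc_re z)) *\<^sub>R 1"
      by (simp add: sc_add_cnj scaleR_conv_of_real)
    finally show ?thesis by simp
  qed
  have "inner (r *\<^sub>R x) y = inner (scale (of_real r) x) y" for y
    by (simp add: inner_eq_re_ip[of "scale (of_real r) x"] ip_scale_left re_mult)
      (simp add: inner_eq_re_ip)
  then show ?thesis
    by (metis inner_eq_zero_iff inner_diff_left right_minus_eq)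
qed

end

text \<open>The real Hilbert spaces of the library are the case of real scalars.\<close>

lemma hilbert_space_real:
  "hilbert_space scaleR (inner :: 'a::{real_inner,complete_space} \<Rightarrow> 'a \<Rightarrow> real)"
  by unfold_locales
    (simp_all add: algebra_simps inner_commute sc_cnj_real_def sc_re_real_def)

text \<open>A complex example.\<close>

lemma hilbert_space_complex: "hilbert_space (*) (\<lambda>x y :: complex. x * cnj y)"
  by unfold_locales
    (simp_all add: algebra_simps inner_complex_def sc_cnj_complex_def sc_re_complex_def)

definition orth_compl :: "('a \<Rightarrow> 'a \<Rightarrow> 'k::zero) \<Rightarrow> 'a set \<Rightarrow> 'a set" where
  "orth_compl ip U = {x. \<forall>y\<in>U. ip x y = 0}"

text \<open>Orthogonal projector onto a closed vector subspace.\<close>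

definition orth_proj :: "('a::ab_group_add \<Rightarrow> 'a \<Rightarrow> 'k::zero) \<Rightarrow> 'a set \<Rightarrow> 'a \<Rightarrow> 'a" where
  "orth_proj ip U x = (THE p. p \<in> U \<and> x - p \<in> orth_compl ip U)"

text \<open>
  Projector onto a nonempty closed affine subspace. The library's \<^term>\<open>closest_point\<close> is
  restricted to Heine--Borel spaces, hence to finite dimension.
\<close>

definition proj_onto :: "'a::metric_space set \<Rightarrow> 'a \<Rightarrow> 'a" where
  "proj_onto S x = (THE p. p \<in> S \<and> (\<forall>y\<in>S. dist x p \<le> dist x y))"

definition IBAP :: "('a::ab_group_add \<Rightarrow> 'a \<Rightarrow> 'k::zero) \<Rightarrow> nat \<Rightarrow> (nat \<Rightarrow> 'a set) \<Rightarrow> bool" where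
  "IBAP ip m U \<longleftrightarrow>
    (\<forall>u. (\<forall>i\<in>{1..m}. u i \<in> U i) \<longrightarrow> (\<exists>x. \<forall>i\<in>{1..m}. orth_proj ip (U i) x = u i))"

text \<open>The sum \<open>U\<^sub>i\<^sub>+\<close>; the library's addition of sets is the Minkowski sum.\<close>

definition tail_sum :: "nat \<Rightarrow> (nat \<Rightarrow> 'a::comm_monoid_add set) \<Rightarrow> nat \<Rightarrow> 'a set" where
  "tail_sum m U i = (\<Sum>j\<in>{i+1..m}. U j)"

definition tail_proj ::
  "('a::{ab_group_add,topological_space} \<Rightarrow> 'a \<Rightarrow> 'k::zero) \<Rightarrow> nat \<Rightarrow> (nat \<Rightarrow> 'a set) \<Rightarrow> nat \<Rightarrow> 'a \<Rightarrow> 'a"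
  where "tail_proj ip m U i = orth_proj ip (closure (tail_sum m U i))"

text \<open>
  The operators \<open>Id - P\<^sub>i P\<^sub>i\<^sub>+\<close> and \<open>Id - P\<^sub>i\<^sub>+ P\<^sub>i\<close>, and \<open>T\<^sub>i\<close> as a total function; its inverses are
  meaningful only once these two operators are known to be bijections of the whole space.
\<close>

definition op_A ::
  "('a::{ab_group_add,topological_space} \<Rightarrow> 'a \<Rightarrow> 'k::zero) \<Rightarrow> nat \<Rightarrow> (nat \<Rightarrow> 'a set) \<Rightarrow> nat \<Rightarrow> 'a \<Rightarrow> 'a"
  where "op_A ip m U i x = x - orth_proj ip (U i) (tail_proj ip m U i x)"

definition op_B ::
  "('a::{ab_group_add,topological_space} \<Rightarrow> 'a \<Rightarrow> 'k::zero) \<Rightarrow> nat \<Rightarrow> (nat \<Rightarrow> 'a set) \<Rightarrow> nat \<Rightarrow> 'a \<Rightarrow> 'a"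
  where "op_B ip m U i x = x - tail_proj ip m U i (orth_proj ip (U i) x)"

definition op_T ::
  "('a::{ab_group_add,topological_space} \<Rightarrow> 'a \<Rightarrow> 'k::zero) \<Rightarrow> nat \<Rightarrow> (nat \<Rightarrow> 'a set) \<Rightarrow> (nat \<Rightarrow> 'a)
    \<Rightarrow> nat \<Rightarrow> 'a \<Rightarrow> 'a"
  where "op_T ip m U u i v =
    inv (op_A ip m U i) (u i - orth_proj ip (U i) v) +
    inv (op_B ip m U i) (v - tail_proj ip m U i (u i))"

definition sol_set ::
  "('a::ab_group_add \<Rightarrow> 'a \<Rightarrow> 'k::zero) \<Rightarrow> nat \<Rightarrow> (nat \<Rightarrow> 'a set) \<Rightarrow> (nat \<Rightarrow> 'a) \<Rightarrow> nat \<Rightarrow> 'a set" where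
  "sol_set ip m U u i = (\<Inter>j\<in>{i..m}. u j +o orth_compl ip (U j))"

end

theory Submission
  imports Defs
begin

text \<open>
  Only the real Hilbert space structure matters. For a subspace over the scalar field, the
  orthogonal complement with respect to \<open>ip\<close> equals the one with respect to the real inner product
  (\<open>hilbert_space.orth_compl_eq_real\<close>), so the projectors coincide, and everything below happens
  in a real Hilbert space. Write \<open>W\<^sub>i\<close> for \<open>U\<^sub>i\<^sub>+\<close> and \<open>Q\<^sub>i\<close> for the projector onto it.

  The point is that the inverse best approximation property forces a positive angle between \<open>U\<^sub>i\<close>
  and \<open>W\<^sub>i\<close>. It provides for every \<open>w \<in> U\<^sub>i\<close> a vector \<open>x\<close> with \<open>P\<^sub>i x = w\<close> and \<open>x \<bottom> W\<^sub>i\<close>. For \<open>a \<in> U\<^sub>i\<close>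
  and \<open>b \<in> W\<^sub>i\<close> then \<open>\<langle>w, a\<rangle> = \<langle>x, a + b\<rangle>\<close>, so the components \<open>a\<close> of the sums \<open>a + b\<close> of norm at most
  \<open>1\<close> form a weakly bounded set. By uniform boundedness this set is bounded, that is,
  \<open>\<parallel>a\<parallel> \<le> C \<parallel>a + b\<parallel>\<close> for a constant \<open>C\<close> (\<open>component_bound\<close>). This estimate has two consequences.
  If \<open>W\<^sub>i\<close> is closed, so is \<open>U\<^sub>i + W\<^sub>i\<close> (\<open>closed_subspace_sum\<close>); hence all tails are closed, by
  descending induction, and the closures in the definition of the \<open>Q\<^sub>i\<close> disappear. Moreover
  \<open>Q\<^sub>i P\<^sub>i\<close> and \<open>P\<^sub>i Q\<^sub>i\<close> have norm below \<open>1\<close> (\<open>proj_comp_contraction\<close>), so by the contraction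
  principle \<open>Id - P\<^sub>i Q\<^sub>i\<close> and \<open>Id - Q\<^sub>i P\<^sub>i\<close> are bijective and \<open>T\<^sub>i\<close> is well defined.

  For \<open>v \<in> W\<^sub>i\<close>, the vector \<open>x = T\<^sub>i v\<close> lies in \<open>U\<^sub>i + W\<^sub>i\<close> and satisfies \<open>P\<^sub>i x = u\<^sub>i\<close> and \<open>Q\<^sub>i x = v\<close>
  (\<open>two_projection_solution\<close>). The second equation preserves the constraints already met by \<open>v\<close>,
  because \<open>U\<^sub>j \<subseteq> W\<^sub>i\<close> for \<open>j > i\<close>. So the recursion produces a point of \<open>S\<^sub>i\<close> that lies in
  \<open>U\<^sub>i + \<dots> + U\<^sub>m\<close> (\<open>backward_solution\<close>). Any other point of \<open>S\<^sub>i\<close> differs from it by a vector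
  orthogonal to this sum, and is longer by Pythagoras (\<open>norm_less_of_mem_tail\<close>).
\<close>

section \<open>Orthogonal projections in a real Hilbert space\<close>

locale closed_subspace =
  fixes U :: "'a::{real_inner,complete_space} set"
  assumes subspace: "subspace U" and closed: "closed U"
begin

text \<open>
  A point of \<open>U\<close> that is nearest to \<open>x\<close> up to a small error has a residual that is nearly
  orthogonal to \<open>U\<close>. Near-orthogonality alone makes a minimizing sequence Cauchy and passes to
  the limit.
\<close>

lemma orth_decomposition:
  obtains p where "p \<in> U" "\<And>y. y \<in> U \<Longrightarrow> inner (x - p) y = 0"
proof -
  define d where "d = (INF u\<in>U. (norm (x - u))\<^sup>2)"
  have d_le: "d \<le> (norm (x - u))\<^sup>2" if "u \<in> U" for u
    unfolding d_def using that by (intro cINF_lower bdd_belowI2[where m = 0]) auto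
  have "\<exists>u\<in>U. (norm (x - u))\<^sup>2 < d + inverse (real (Suc n))" for n
  proof -
    have "(INF u\<in>U. (norm (x - u))\<^sup>2) < d + inverse (real (Suc n))"
      by (simp add: d_def)
    moreover have "U \<noteq> {}"
      using subspace_0[OF subspace] by auto
    ultimately show ?thesis
      using cInf_lessD[of "(\<lambda>u. (norm (x - u))\<^sup>2) ` U"] by auto
  qed
  then obtain s where s: "\<And>n. s n \<in> U"
    and s_near: "\<And>n. (norm (x - s n))\<^sup>2 < d + inverse (real (Suc n))"
    by metis
  define r where "r n = sqrt (inverse (real (Suc n)))" for n
  have r: "r \<longlonglongrightarrow> 0"
    unfolding r_def using tendsto_real_sqrt[OF LIMSEQ_inverse_real_of_nat] by simp
  have near_orth: "\<bar>inner (x - s n) y\<bar> \<le> r n * norm y" if y: "y \<in> U" for n y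
  proof (cases "y = 0")
    case False
    \<comment> \<open>The step along \<open>y\<close> that reduces the distance to \<open>x\<close> most.\<close>
    define t where "t = inner (x - s n) y / (norm y)\<^sup>2"
    have n0: "(norm y)\<^sup>2 > 0" using False by simp
    have "d \<le> (norm (x - (s n + t *\<^sub>R y)))\<^sup>2"
      by (intro d_le subspace_add subspace_scale subspace s y)
    also have "\<dots> = (norm (x - s n - t *\<^sub>R y))\<^sup>2"
      by (simp add: algebra_simps)
    also have "\<dots> = (norm (x - s n))\<^sup>2 - 2 * t * inner (x - s n) y + t\<^sup>2 * (norm y)\<^sup>2"
    proof -
      have "(norm (z - t *\<^sub>R y))\<^sup>2 = (norm z)\<^sup>2 - 2 * t * inner z y + t * t * (norm y)\<^sup>2" for z
        by (simp only: power2_norm_eq_inner inner_diff_left inner_diff_right)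
          (simp add: inner_commute algebra_simps)
      then show ?thesis by (simp only: power2_eq_square[of t])
    qed
    also have "\<dots> = (norm (x - s n))\<^sup>2 - (inner (x - s n) y)\<^sup>2 / (norm y)\<^sup>2"
      using n0 by (simp add: t_def field_simps power2_eq_square)
    finally have "(inner (x - s n) y)\<^sup>2 / (norm y)\<^sup>2 \<le> inverse (real (Suc n))"
      using s_near[of n] by linarith
    then have "(inner (x - s n) y)\<^sup>2 \<le> (r n * norm y)\<^sup>2"
      using n0 by (simp add: r_def power_mult_distrib pos_divide_le_eq)
    moreover have "0 \<le> r n * norm y"
      by (simp add: r_def)
    ultimately show ?thesis
      using abs_le_square_iff[of "inner (x - s n) y" "r n * norm y"] by simp
  qed simp
  have gap: "norm (s i - s j) \<le> r i + r j" for i j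
  proof (cases "s i = s j")
    case False
    have y: "s i - s j \<in> U" by (intro subspace_diff subspace s)
    have "(norm (s i - s j))\<^sup>2 = inner (x - s j) (s i - s j) - inner (x - s i) (s i - s j)"
      by (simp add: power2_norm_eq_inner inner_diff_left)
    also have "\<dots> \<le> r j * norm (s i - s j) + r i * norm (s i - s j)"
      using near_orth[OF y, of i] near_orth[OF y, of j] by linarith
    finally have "norm (s i - s j) * norm (s i - s j) \<le> (r i + r j) * norm (s i - s j)"
      by (simp add: power2_eq_square algebra_simps)
    then show ?thesis using False by simp
  qed (simp add: r_def)
  have "Cauchy s"
  proof (rule metric_CauchyI)
    fix e :: real assume "0 < e"
    then obtain N where N: "\<And>n. n \<ge> N \<Longrightarrow> \<bar>r n\<bar> < e / 2"
      using LIMSEQ_D[OF r, of "e / 2"] by auto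
    then have "dist (s i) (s j) < e" if "i \<ge> N" "j \<ge> N" for i j
      using gap[of i j] N[OF that(1)] N[OF that(2)] by (simp add: dist_norm)
    then show "\<exists>M. \<forall>i\<ge>M. \<forall>j\<ge>M. dist (s i) (s j) < e" by blast
  qed
  then obtain p where p: "s \<longlonglongrightarrow> p"
    using Cauchy_convergent convergent_def by blast
  have "p \<in> U"
    using closed_sequentially[OF closed _ p] s by blast
  moreover have "inner (x - p) y = 0" if y: "y \<in> U" for y
  proof (rule LIMSEQ_unique)
    show "(\<lambda>n. inner (x - s n) y) \<longlonglongrightarrow> inner (x - p) y"
      by (intro tendsto_intros p)
    show "(\<lambda>n. inner (x - s n) y) \<longlonglongrightarrow> 0"
    proof (rule Lim_null_comparison)
      show "\<forall>\<^sub>F n in sequentially. norm (inner (x - s n) y) \<le> r n * norm y"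
        using near_orth[OF y] by simp
      show "(\<lambda>n. r n * norm y) \<longlonglongrightarrow> 0"
        using tendsto_mult[OF r tendsto_const[of "norm y"]] by simp
    qed
  qed
  ultimately show thesis by (rule that)
qed

abbreviation P :: "'a \<Rightarrow> 'a" where "P \<equiv> orth_proj inner U"

lemma proj_eqI:
  assumes "p \<in> U" "\<And>y. y \<in> U \<Longrightarrow> inner (x - p) y = 0"
  shows "P x = p"
  unfolding orth_proj_def orth_compl_def
proof (rule the_equality)
  show "p \<in> U \<and> x - p \<in> {x. \<forall>y\<in>U. inner x y = 0}"
    using assms by simp
  fix q assume q: "q \<in> U \<and> x - q \<in> {x. \<forall>y\<in>U. inner x y = 0}"
  then have "q - p \<in> U" by (simp add: subspace_diff subspace assms)
  then have "inner (x - p) (q - p) - inner (x - q) (q - p) = 0"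
    using q assms(2) by simp
  then have "inner (q - p) (q - p) = 0"
    by (simp add: inner_diff_left)
  then show "q = p" by simp
qed

lemma proj_mem: "P x \<in> U" and proj_orth: "y \<in> U \<Longrightarrow> inner (x - P x) y = 0"
proof -
  obtain p where p: "p \<in> U" "\<And>y. y \<in> U \<Longrightarrow> inner (x - p) y = 0"
    using orth_decomposition[of x] by metis
  then have "P x = p" by (rule proj_eqI)
  with p show "P x \<in> U" "y \<in> U \<Longrightarrow> inner (x - P x) y = 0" by simp_all
qed

lemma inner_proj: "y \<in> U \<Longrightarrow> inner (P x) y = inner x y"
  using proj_orth[of y x] by (simp add: inner_diff_left)

lemma proj_eq_iff:
  assumes "p \<in> U"
  shows "P x = p \<longleftrightarrow> (\<forall>y\<in>U. inner (x - p) y = 0)"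
proof
  show "P x = p \<Longrightarrow> \<forall>y\<in>U. inner (x - p) y = 0"
    using proj_orth[of _ x] by auto
  show "\<forall>y\<in>U. inner (x - p) y = 0 \<Longrightarrow> P x = p"
    using proj_eqI[OF assms] by auto
qed

lemma proj_id: "x \<in> U \<Longrightarrow> P x = x"
  by (rule proj_eqI) auto

lemma proj_add: "P (x + y) = P x + P y"
  by (rule proj_eqI)
    (auto simp: subspace_add subspace proj_mem inner_proj inner_diff_left inner_add_left)

lemma proj_diff: "P (x - y) = P x - P y"
  by (rule proj_eqI)
    (auto simp: subspace_diff subspace proj_mem inner_proj inner_diff_left)

lemma proj_pythagoras: "(norm x)\<^sup>2 = (norm (P x))\<^sup>2 + (norm (x - P x))\<^sup>2"
  using proj_orth[OF proj_mem, of x x]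
  by (simp add: power2_norm_eq_inner inner_diff_left inner_diff_right inner_commute)

lemma norm_proj_le: "norm (P x) \<le> norm x"
  by (rule power2_le_imp_le) (simp_all add: proj_pythagoras[of x])

end

section \<open>Weakly bounded sets\<close>

text \<open>
  The uniform boundedness principle for functionals on a Hilbert space, from Baire's theorem.
\<close>

lemma weakly_bounded_imp_bounded:
  fixes B :: "'a::{real_inner,complete_space} set"
  assumes weak: "\<And>w. \<exists>M. \<forall>b\<in>B. \<bar>inner w b\<bar> \<le> M"
  shows "bounded B"
proof -
  define E where "E n = (\<Inter>b\<in>B. {w. \<bar>inner w b\<bar> \<le> real n})" for n
  have closed_E: "closed (E n)" for n
    unfolding E_def by (intro closed_INT ballI closed_Collect_le continuous_intros)
  have cover: "(\<Union>n. E n) = UNIV"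
  proof -
    have "\<exists>n. w \<in> E n" for w
    proof -
      obtain M where M: "\<forall>b\<in>B. \<bar>inner w b\<bar> \<le> M" using weak by blast
      obtain n where "M \<le> real n" using real_arch_simple by blast
      with M have "w \<in> E n" by (force simp: E_def)
      then show ?thesis ..
    qed
    then show ?thesis by blast
  qed
  have "\<exists>n. interior (E n) \<noteq> {}"
  proof (rule ccontr)
    assume "\<nexists>n. interior (E n) \<noteq> {}"
    then have "euclidean interior_of \<Union>(range E) = {}"
      using closed_E
      by (intro Baire_category_alt) (auto simp: completely_metrizable_space_euclidean)
    then show False using cover by simp
  qed
  then obtain n w0 where "w0 \<in> interior (E n)" by blast
  then obtain r where r: "r > 0" "cball w0 r \<subseteq> E n"
    by (meson mem_interior_cball)
  have "norm b \<le> 2 * real n / r" if b: "b \<in> B" for b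
  proof (cases "b = 0")
    case False
    \<comment> \<open>The point of the ball on which the functional \<open>b\<close> differs most from its value at \<open>w0\<close>.\<close>
    define z where "z = w0 + (r / norm b) *\<^sub>R b"
    have "z \<in> cball w0 r" "w0 \<in> cball w0 r"
      using r False by (simp_all add: z_def dist_norm)
    then have "\<bar>inner z b\<bar> \<le> real n" "\<bar>inner w0 b\<bar> \<le> real n"
      using r b unfolding E_def by blast+
    moreover have "inner z b = inner w0 b + r * norm b"
      using False by (simp add: z_def inner_add_left dot_square_norm power2_eq_square)
    ultimately have "r * norm b \<le> 2 * real n" by linarith
    then show ?thesis using r by (simp add: field_simps)
  qed (use r in simp)
  then show ?thesis by (auto simp: bounded_iff)
qed

section \<open>Two subspaces at a positive angle\<close>

lemma (in module) subspace_set_plus: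
  assumes "subspace A" "subspace B"
  shows "subspace (A + B)"
  unfolding subspace_def
proof (intro conjI allI ballI)
  show "0 \<in> A + B"
    using set_plus_intro[OF subspace_0[OF assms(1)] subspace_0[OF assms(2)]] by simp
  fix x y c assume "x \<in> A + B"
  then obtain a b where x: "x = a + b" "a \<in> A" "b \<in> B" by (rule set_plus_elim)
  have "scale c a + scale c b \<in> A + B"
    by (intro set_plus_intro subspace_scale assms x)
  then show "scale c x \<in> A + B" by (simp add: x scale_right_distrib)
  assume "y \<in> A + B"
  then obtain a' b' where y: "y = a' + b'" "a' \<in> A" "b' \<in> B" by (rule set_plus_elim)
  have "(a + a') + (b + b') \<in> A + B"
    by (intro set_plus_intro subspace_add assms x y)
  then show "x + y \<in> A + B" by (simp add: x y algebra_simps)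
qed

text \<open>
  The projection \<open>a + b \<mapsto> a\<close> of \<open>U + W\<close> along \<open>W\<close> is bounded, and in particular the sum is
  direct. The lifts give it weakly: \<open>\<langle>w, a\<rangle> = \<langle>x, a + b\<rangle>\<close> if \<open>x\<close> has the same projection on
  \<open>U\<close> as \<open>w\<close> and is orthogonal to \<open>W\<close>.
\<close>

lemma component_bound:
  assumes U: "closed_subspace U" and W: "subspace W"
    and lift: "\<And>w. w \<in> U \<Longrightarrow> \<exists>x. orth_proj inner U x = w \<and> (\<forall>b\<in>W. inner x b = 0)"
  shows "\<exists>C>0. \<forall>a\<in>U. \<forall>b\<in>W. norm a \<le> C * norm (a + b)"
proof -
  interpret U: closed_subspace U by (fact U)
  define B where "B = {a \<in> U. \<exists>b\<in>W. norm (a + b) \<le> 1}"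
  have "bounded B"
  proof (rule weakly_bounded_imp_bounded)
    fix w
    obtain x where x: "U.P x = U.P w" "\<forall>b\<in>W. inner x b = 0"
      using lift U.proj_mem by blast
    have "\<bar>inner w a\<bar> \<le> norm x" if "a \<in> U" "b \<in> W" "norm (a + b) \<le> 1" for a b
    proof -
      have "inner w a = inner x a"
        using U.inner_proj[OF that(1)] x(1) by metis
      also have "\<dots> = inner x (a + b)"
        using x(2) that(2) by (simp add: inner_add_right)
      finally have "\<bar>inner w a\<bar> \<le> norm x * norm (a + b)"
        by (simp add: Cauchy_Schwarz_ineq2)
      also have "\<dots> \<le> norm x"
        using that(3) by (simp add: mult_left_le)
      finally show ?thesis .
    qed
    then show "\<exists>M. \<forall>a\<in>B. \<bar>inner w a\<bar> \<le> M"
      unfolding B_def by blast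
  qed
  then obtain C where C: "C > 0" "\<And>a. a \<in> B \<Longrightarrow> norm a \<le> C"
    using bounded_pos by blast
  have scaled: "t * norm a \<le> C" if "a \<in> U" "b \<in> W" "t \<ge> 0" "t * norm (a + b) \<le> 1" for a b t
  proof -
    have "t *\<^sub>R a \<in> B"
      unfolding B_def using that
      by (auto intro!: bexI[of _ "t *\<^sub>R b"] subspace_scale U.subspace W
          simp flip: scaleR_add_right)
    from C(2)[OF this] show ?thesis using that by simp
  qed
  \<comment> \<open>If \<open>a + b = 0\<close>, every multiple of \<open>a\<close> belongs to the bounded set \<open>B\<close>, which forces \<open>a = 0\<close>.\<close>
  have "norm a \<le> C * norm (a + b)" if ab: "a \<in> U" "b \<in> W" for a b
  proof (cases "a + b = 0")
    case True
    have "a = 0"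
    proof (rule ccontr)
      assume "a \<noteq> 0"
      then show False
        using scaled[OF ab, of "(C + 1) / norm a"] C(1) True by simp
    qed
    with C(1) show ?thesis by simp
  next
    case False
    then show ?thesis
      using scaled[OF ab, of "1 / norm (a + b)"] by (simp add: field_simps)
  qed
  with C(1) show ?thesis by blast
qed

text \<open>
  The bound makes the \<open>U\<close>-components of a convergent sequence in \<open>U + W\<close> converge, and with
  them the \<open>W\<close>-components.
\<close>

lemma closed_subspace_sum:
  assumes U: "closed_subspace U" and W: "closed_subspace W"
    and bound: "\<And>a b. a \<in> U \<Longrightarrow> b \<in> W \<Longrightarrow> norm a \<le> C * norm (a + b)"
  shows "closed_subspace (U + W)"
proof
  interpret U: closed_subspace U by (fact U)
  interpret W: closed_subspace W by (fact W)
  show "subspace (U + W)"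
    by (rule real_vector.subspace_set_plus[OF U.subspace W.subspace])
  show "closed (U + W)"
    unfolding closed_sequential_limits
  proof (intro allI impI, elim conjE)
    fix z l assume z: "\<forall>n. z n \<in> U + W" and l: "z \<longlonglongrightarrow> l"
    have "\<exists>a. a \<in> U \<and> z n - a \<in> W" for n
      using z by (metis add_diff_cancel_left' set_plus_elim)
    then obtain a where a: "\<And>n. a n \<in> U" "\<And>n. z n - a n \<in> W"
      by metis
    have gap: "norm (a i - a j) \<le> C * norm (z i - z j)" for i j
    proof -
      have "a i - a j \<in> U" "(z i - a i) - (z j - a j) \<in> W"
        by (intro subspace_diff U.subspace W.subspace a)+
      from bound[OF this] show ?thesis by (simp add: algebra_simps)
    qed
    have "Cauchy a"
    proof (rule metric_CauchyI)
      fix e :: real assume e: "0 < e"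
      define D where "D = max C 1"
      have D: "D > 0" "C \<le> D" by (simp_all add: D_def)
      obtain N where N: "\<And>i j. i \<ge> N \<Longrightarrow> j \<ge> N \<Longrightarrow> dist (z i) (z j) < e / D"
        using metric_CauchyD[OF LIMSEQ_imp_Cauchy[OF l], of "e / D"] e D by fastforce
      have "dist (a i) (a j) < e" if "i \<ge> N" "j \<ge> N" for i j
      proof -
        have "dist (a i) (a j) \<le> D * dist (z i) (z j)"
          using gap[of i j] mult_right_mono[OF D(2), of "norm (z i - z j)"]
          by (simp add: dist_norm)
        also have "\<dots> < e"
          using N[OF that] D by (simp add: field_simps)
        finally show ?thesis .
      qed
      then show "\<exists>M. \<forall>i\<ge>M. \<forall>j\<ge>M. dist (a i) (a j) < e" by blast
    qed
    then obtain p where p: "a \<longlonglongrightarrow> p"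
      using Cauchy_convergent convergent_def by blast
    have "p \<in> U" using closed_sequentially[OF U.closed _ p] a by blast
    moreover have "l - p \<in> W"
      using closed_sequentially[OF W.closed _ tendsto_diff[OF l p]] a by blast
    ultimately have "p + (l - p) \<in> U + W" by (rule set_plus_intro)
    then show "l \<in> U + W" by simp
  qed
qed

text \<open>
  Taking \<open>b\<close> as minus the projection of \<open>a\<close> on \<open>W\<close>, the bound says that \<open>a\<close> keeps a fixed
  proportion of its length outside \<open>W\<close>, and Pythagoras yields the factor \<open>q\<close> for one order of the
  projectors. The other order is the adjoint and has the same norm.
\<close>

lemma proj_comp_contraction:
  assumes U: "closed_subspace U" and W: "closed_subspace W"
    and C: "C > 0" and bound: "\<And>a b. a \<in> U \<Longrightarrow> b \<in> W \<Longrightarrow> norm a \<le> C * norm (a + b)"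
  obtains q where "0 \<le> q" "q < 1"
    "\<And>x. norm (orth_proj inner W (orth_proj inner U x)) \<le> q * norm x"
    "\<And>x. norm (orth_proj inner U (orth_proj inner W x)) \<le> q * norm x"
proof -
  interpret U: closed_subspace U by (fact U)
  interpret W: closed_subspace W by (fact W)
  \<comment> \<open>Raising the constant to at least \<open>1\<close> keeps the argument of the root nonnegative.\<close>
  define D where "D = max C 1"
  define q where "q = sqrt (1 - 1 / D\<^sup>2)"
  have D: "D \<ge> 1" "C \<le> D" by (simp_all add: D_def)
  then have D2: "D\<^sup>2 \<ge> 1" by simp
  have q: "0 \<le> q" "q < 1" "q\<^sup>2 = 1 - 1 / D\<^sup>2"
    using D2 by (auto simp: q_def divide_le_eq)
  have on_U: "norm (W.P a) \<le> q * norm a" if a: "a \<in> U" for a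
  proof (rule power2_le_imp_le)
    have "norm a \<le> C * norm (a + - W.P a)"
      by (intro bound a subspace_neg W.subspace W.proj_mem)
    also have "\<dots> \<le> D * norm (a - W.P a)"
      using D by (simp add: mult_right_mono)
    finally have "(norm a)\<^sup>2 \<le> (D * norm (a - W.P a))\<^sup>2"
      by (rule power_mono) simp
    then have "(norm a)\<^sup>2 / D\<^sup>2 \<le> (norm (a - W.P a))\<^sup>2"
      using D by (simp add: power_mult_distrib pos_divide_le_eq mult.commute)
    then show "(norm (W.P a))\<^sup>2 \<le> (q * norm a)\<^sup>2"
      using W.proj_pythagoras[of a] by (simp add: power_mult_distrib q(3) algebra_simps add_divide_distrib)
    show "0 \<le> q * norm a" using q by simp
  qed
  have UW: "norm (W.P (U.P x)) \<le> q * norm x" for x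
    using on_U[OF U.proj_mem, of x] mult_left_mono[OF U.norm_proj_le q(1), of x] by linarith
  have WU: "norm (U.P (W.P x)) \<le> q * norm x" for x
  proof -
    define b where "b = W.P x"
    have "norm (U.P b) * norm (U.P b) = inner (U.P b) (U.P b)"
      by (simp add: dot_square_norm power2_eq_square)
    also have "\<dots> = inner b (U.P b)"
      by (simp add: U.inner_proj U.proj_mem)
    also have "\<dots> = inner b (W.P (U.P b))"
      using W.inner_proj[of b "U.P b"] W.proj_mem[of x] by (simp add: inner_commute b_def)
    also have "\<dots> \<le> norm b * (q * norm (U.P b))"
      by (meson norm_cauchy_schwarz on_U U.proj_mem mult_left_mono norm_ge_zero order_trans)
    finally have "norm (U.P b) * norm (U.P b) \<le> (q * norm b) * norm (U.P b)"
      by (simp add: algebra_simps)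
    then have "norm (U.P b) \<le> q * norm b"
      using q by (cases "U.P b = 0") auto
    also have "\<dots> \<le> q * norm x"
      using q by (simp add: b_def W.norm_proj_le mult_left_mono)
    finally show ?thesis by (simp add: b_def)
  qed
  show thesis by (rule that[OF q(1,2) UW WU])
qed

lemma bij_id_minus_contraction:
  fixes f :: "'a::{real_normed_vector,complete_space} \<Rightarrow> 'a"
  assumes diff: "\<And>x y. f (x - y) = f x - f y"
    and q: "0 \<le> q" "q < 1" "\<And>x. norm (f x) \<le> q * norm x"
  shows "bij (\<lambda>x. x - f x)"
  unfolding bij_iff
proof
  fix y
  have "\<exists>!x. y + f x = x"
    by (rule banach_fix_type[OF q(1,2)]) (simp add: dist_norm q(3) flip: diff)
  moreover have "x - f x = y \<longleftrightarrow> y + f x = x" for x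
    by (auto simp: algebra_simps)
  ultimately show "\<exists>!x. x - f x = y" by simp
qed

text \<open>
  The two terms of \<open>x\<close> are the \<open>U\<close>-component \<open>a\<close> and the \<open>W\<close>-component \<open>b\<close> of the solution. With
  \<open>P\<close> and \<open>Q\<close> the projectors onto \<open>U\<close> and \<open>W\<close>, the two constraints read \<open>a + P b = u\<close> and
  \<open>Q a + b = v\<close>, and eliminating \<open>b\<close> or \<open>a\<close> gives \<open>(Id - P Q) a = u - P v\<close> and
  \<open>(Id - Q P) b = v - Q u\<close>.
\<close>

lemma two_projection_solution:
  assumes U: "closed_subspace U" and W: "closed_subspace W"
    and bijA: "bij (\<lambda>x. x - orth_proj inner U (orth_proj inner W x))"
    and bijB: "bij (\<lambda>x. x - orth_proj inner W (orth_proj inner U x))"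
    and u: "u \<in> U" and v: "v \<in> W"
    and x: "x = inv (\<lambda>x. x - orth_proj inner U (orth_proj inner W x)) (u - orth_proj inner U v)
      + inv (\<lambda>x. x - orth_proj inner W (orth_proj inner U x)) (v - orth_proj inner W u)"
  shows "x \<in> U + W" "orth_proj inner U x = u" "orth_proj inner W x = v"
proof -
  interpret U: closed_subspace U by (fact U)
  interpret W: closed_subspace W by (fact W)
  define a where "a = inv (\<lambda>x. x - U.P (W.P x)) (u - U.P v)"
  define b where "b = inv (\<lambda>x. x - W.P (U.P x)) (v - W.P u)"
  have "a - U.P (W.P a) = u - U.P v"
    using surj_f_inv_f[OF bij_is_surj[OF bijA]] unfolding a_def .
  then have a: "a = u - U.P v + U.P (W.P a)"
    by (simp add: diff_eq_eq)
  have "u - U.P v + U.P (W.P a) \<in> U"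
    by (intro subspace_add subspace_diff U.subspace u U.proj_mem)
  then have aU: "a \<in> U" using a by simp
  \<comment> \<open>The candidate for \<open>b\<close> dictated by the second constraint; it solves the equation that defines \<open>b\<close>.\<close>
  define c where "c = v - W.P a"
  have cW: "c \<in> W"
    unfolding c_def by (intro subspace_diff W.subspace v W.proj_mem)
  have Uc: "U.P c = u - a"
    using a by (simp add: c_def U.proj_diff algebra_simps)
  then have "c - W.P (U.P c) = v - W.P u"
    by (simp add: c_def W.proj_diff)
  then have "b = c"
    unfolding b_def using inv_f_f[OF bij_is_inj[OF bijB], of c] by simp
  then have x: "x = a + c" by (simp add: x a_def b_def)
  show "x \<in> U + W" unfolding x by (rule set_plus_intro[OF aU cW])
  show "U.P x = u" by (simp add: x U.proj_add U.proj_id[OF aU] Uc)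
  show "W.P x = v" by (simp add: x W.proj_add W.proj_id[OF cW]) (simp add: c_def)
qed

section \<open>Tail sums\<close>

lemma tail_sum_last: "tail_sum m U m = {0}"
  by (simp add: tail_sum_def)

lemma tail_sum_Suc:
  assumes "i < m"
  shows "tail_sum m U i = U (Suc i) + tail_sum m U (Suc i)"
proof -
  have "{i + 1..m} = insert (Suc i) {Suc i + 1..m}" using assms by auto
  then show ?thesis by (simp add: tail_sum_def)
qed

lemma subset_tail_sum:
  assumes "\<And>k. k \<in> {1..m} \<Longrightarrow> 0 \<in> U k" and "j \<in> {i + 1..m}"
  shows "U j \<subseteq> tail_sum m U i"
proof
  fix b assume b: "b \<in> U j"
  have zero: "0 \<in> sum U J" if "finite J" "J \<subseteq> {1..m}" for J
    using that
  proof (induction J)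
    case (insert k J)
    then have "0 + 0 \<in> U k + sum U J"
      using assms(1) by (intro set_plus_intro) auto
    then show ?case using insert by simp
  qed simp
  have "0 \<in> sum U ({i + 1..m} - {j})" by (rule zero) auto
  then have "b + 0 \<in> U j + sum U ({i + 1..m} - {j})"
    using b by (rule set_plus_intro[rotated])
  then show "b \<in> tail_sum m U i"
    using assms(2) by (simp add: tail_sum_def sum.remove)
qed

lemma tail_sum_subset:
  assumes "0 \<in> K" "K + K \<subseteq> K" and "\<And>j. j \<in> {i + 1..m} \<Longrightarrow> U j \<subseteq> K"
  shows "tail_sum m U i \<subseteq> K"
proof -
  have "sum U J \<subseteq> K" if "finite J" "J \<subseteq> {i + 1..m}" for J
    using that
  proof (induction J)
    case (insert j J)
    then have "U j + sum U J \<subseteq> K + K"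
      using assms(3) by (intro set_plus_mono2) auto
    with insert assms(2) show ?case by auto
  qed (simp add: assms(1))
  then show ?thesis by (simp add: tail_sum_def)
qed

lemma orth_tail_sum:
  assumes "\<And>j y. j \<in> {i + 1..m} \<Longrightarrow> y \<in> U j \<Longrightarrow> inner x y = 0" and "b \<in> tail_sum m U i"
  shows "inner x b = 0"
proof -
  have "tail_sum m U i \<subseteq> {y. inner x y = 0}"
    using assms(1) by (intro tail_sum_subset) (auto simp: inner_add_right elim!: set_plus_elim)
  with assms(2) show ?thesis by auto
qed

lemma (in module) subspace_tail_sum:
  assumes "\<And>j. j \<in> {1..m} \<Longrightarrow> subspace (U j)"
  shows "subspace (tail_sum m U i)"
proof -
  have "subspace (sum U J)" if "finite J" "J \<subseteq> {1..m}" for J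
    using that by (induction J) (auto intro!: subspace_set_plus assms)
  then show ?thesis by (simp add: tail_sum_def)
qed

section \<open>Families with the inverse best approximation property\<close>

locale ibap_family =
  fixes m :: nat and U :: "nat \<Rightarrow> 'a::{real_inner,complete_space} set"
  assumes closed_subspace_U: "i \<in> {1..m} \<Longrightarrow> closed_subspace (U i)"
    and ibap: "IBAP inner m U"
begin

abbreviation P :: "nat \<Rightarrow> 'a \<Rightarrow> 'a" where "P i \<equiv> orth_proj inner (U i)"
abbreviation W :: "nat \<Rightarrow> 'a set" where "W \<equiv> tail_sum m U"

lemma zero_mem_U: "i \<in> {1..m} \<Longrightarrow> 0 \<in> U i"
  by (rule subspace_0[OF closed_subspace.subspace[OF closed_subspace_U]])

text \<open>
  Prescribing the projections \<open>w\<close> on \<open>U\<^sub>i\<close> and \<open>0\<close> on all the other subspaces yields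
  exactly the lifts on which \<open>component_bound\<close> rests.
\<close>

lemma lift_orth_tail:
  assumes i: "i \<in> {1..m}" and w: "w \<in> U i"
  shows "\<exists>x. P i x = w \<and> (\<forall>b\<in>W i. inner x b = 0)"
proof -
  define u where "u j = (if j = i then w else 0)" for j
  have "\<forall>j\<in>{1..m}. u j \<in> U j"
    using w zero_mem_U by (simp add: u_def)
  then obtain x where x: "\<And>j. j \<in> {1..m} \<Longrightarrow> P j x = u j"
    using ibap unfolding IBAP_def by blast
  have "inner x b = 0" if "b \<in> W i" for b
  proof (rule orth_tail_sum[OF _ that])
    fix j y assume j: "j \<in> {i + 1..m}" and y: "y \<in> U j"
    then have j': "j \<in> {1..m}" "P j x = 0" using x by (auto simp: u_def)
    show "inner x y = 0"
      using closed_subspace.inner_proj[OF closed_subspace_U[OF j'(1)] y, of x] j'(2) by simp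
  qed
  moreover have "P i x = w" using x[OF i] by (simp add: u_def)
  ultimately show ?thesis by blast
qed

lemma subspace_W: "subspace (W i)"
  by (rule real_vector.subspace_tail_sum[OF closed_subspace.subspace[OF closed_subspace_U]])

lemma angle_bound:
  assumes "i \<in> {1..m}"
  shows "\<exists>C>0. \<forall>a\<in>U i. \<forall>b\<in>W i. norm a \<le> C * norm (a + b)"
  by (rule component_bound[OF closed_subspace_U[OF assms] subspace_W lift_orth_tail[OF assms]])

text \<open>
  Closedness of the tails goes down from \<open>W\<^sub>m = {0}\<close>: each step adds one subspace that is at a
  positive angle to the tail already known to be closed.
\<close>

lemma closed_subspace_W: "i \<le> m \<Longrightarrow> closed_subspace (W i)"
proof (induction i rule: inc_induct)
  case base
  show ?case by unfold_locales (simp_all add: tail_sum_last)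
next
  case (step i)
  then have i: "Suc i \<in> {1..m}" by simp
  obtain C where C: "\<forall>a\<in>U (Suc i). \<forall>b\<in>W (Suc i). norm a \<le> C * norm (a + b)"
    using angle_bound[OF i] by blast
  have "closed_subspace (U (Suc i) + W (Suc i))"
    by (rule closed_subspace_sum[OF closed_subspace_U[OF i] step.IH]) (use C in blast)
  then show ?case using step.hyps by (simp add: tail_sum_Suc)
qed

lemma closure_W: "i \<le> m \<Longrightarrow> closure (W i) = W i"
  by (rule closure_closed[OF closed_subspace.closed[OF closed_subspace_W]])

lemma tail_proj_eq: "i \<le> m \<Longrightarrow> tail_proj inner m U i = orth_proj inner (W i)"
  by (simp add: tail_proj_def closure_W)

lemma bij_op_A_op_B:
  assumes i: "i \<in> {1..m}"
  shows "bij (op_A inner m U i)" "bij (op_B inner m U i)"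
proof -
  have W: "closed_subspace (W i)" using i by (simp add: closed_subspace_W)
  have tp: "tail_proj inner m U i = orth_proj inner (W i)" using i by (simp add: tail_proj_eq)
  obtain C where C: "C > 0" "\<forall>a\<in>U i. \<forall>b\<in>W i. norm a \<le> C * norm (a + b)"
    using angle_bound[OF i] by blast
  have bound: "norm a \<le> C * norm (a + b)" if "a \<in> U i" "b \<in> W i" for a b
    using C(2) that by blast
  obtain q where q: "0 \<le> q" "q < 1"
    "\<And>x. norm (orth_proj inner (W i) (P i x)) \<le> q * norm x"
    "\<And>x. norm (P i (orth_proj inner (W i) x)) \<le> q * norm x"
    using proj_comp_contraction[OF closed_subspace_U[OF i] W C(1) bound] by metis
  note diff = closed_subspace.proj_diff[OF closed_subspace_U[OF i]] closed_subspace.proj_diff[OF W]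
  show "bij (op_A inner m U i)"
    unfolding op_A_def tp by (rule bij_id_minus_contraction[OF _ q(1,2,4)]) (simp add: diff)
  show "bij (op_B inner m U i)"
    unfolding op_B_def tp by (rule bij_id_minus_contraction[OF _ q(1,2,3)]) (simp add: diff)
qed

lemma op_T_solution:
  assumes i: "i \<in> {1..m}" and u: "u i \<in> U i" and v: "v \<in> W i"
  shows "op_T inner m U u i v \<in> U i + W i"
    "P i (op_T inner m U u i v) = u i"
    "orth_proj inner (W i) (op_T inner m U u i v) = v"
proof -
  have W: "closed_subspace (W i)" using i by (simp add: closed_subspace_W)
  have tp: "tail_proj inner m U i = orth_proj inner (W i)" using i by (simp add: tail_proj_eq)
  note AB = op_A_def[of inner m U i, unfolded tp, abs_def] op_B_def[of inner m U i, unfolded tp, abs_def]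
  note bij = bij_op_A_op_B[OF i, unfolded AB]
  have "op_T inner m U u i v =
      inv (\<lambda>x. x - P i (orth_proj inner (W i) x)) (u i - P i v) +
      inv (\<lambda>x. x - orth_proj inner (W i) (P i x)) (v - orth_proj inner (W i) (u i))"
    by (simp add: op_T_def AB tp)
  note * = two_projection_solution[OF closed_subspace_U[OF i] W bij u v this]
  show "op_T inner m U u i v \<in> U i + W i" by (rule *)
  show "P i (op_T inner m U u i v) = u i" by (rule *)
  show "orth_proj inner (W i) (op_T inner m U u i v) = v" by (rule *)
qed

lemma U_subset_W: "j \<in> {i + 1..m} \<Longrightarrow> U j \<subseteq> W i"
  by (rule subset_tail_sum[OF zero_mem_U])

text \<open>
  The invariant of the backward recursion, shifted so that \<open>W\<^sub>i = U\<^sub>i\<^sub>+\<^sub>1 + \<dots> + U\<^sub>m\<close> is the sum of the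
  subspaces whose constraints \<open>x\<^sub>i\<^sub>+\<^sub>1\<close> has to meet. A step adds the constraint on the new subspace
  and keeps the value of the projection on the old tail; as that tail contains the later
  subspaces, the later constraints persist.
\<close>

lemma backward_solution:
  assumes u: "\<And>i. i \<in> {1..m} \<Longrightarrow> u i \<in> U i"
    and last: "xbar m = u m"
    and rec: "\<And>i. i \<in> {1..<m} \<Longrightarrow> xbar i = op_T inner m U u i (xbar (i + 1))"
    and i: "i < m"
  shows "xbar (Suc i) \<in> W i \<and> (\<forall>j\<in>{Suc i..m}. P j (xbar (Suc i)) = u j)"
proof -
  have "i \<le> m - 1" using i by simp
  then show ?thesis
  proof (induction i rule: inc_induct)
    case base
    have m: "m \<in> {1..m}" "Suc (m - 1) = m" using i by auto
    have "xbar m \<in> W (m - 1)"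
      using u[OF m(1)] U_subset_W[of m "m - 1"] m by (auto simp: last)
    then show ?case
      using closed_subspace.proj_id[OF closed_subspace_U[OF m(1)] u[OF m(1)]]
      unfolding m(2) by (simp add: last)
  next
    case (step k)
    define n where "n = Suc k"
    have n: "n \<in> {1..m}" "n \<in> {1..<m}" "k < m" using step.hyps by (auto simp: n_def)
    have IH: "xbar (Suc n) \<in> W n" "\<And>j. j \<in> {Suc n..m} \<Longrightarrow> P j (xbar (Suc n)) = u j"
      using step.IH by (auto simp: n_def)
    have x: "xbar n = op_T inner m U u n (xbar (Suc n))" using rec[OF n(2)] by simp
    note sol = op_T_solution[where u = u, OF n(1) u[OF n(1)] IH(1), folded x]
    have "xbar n \<in> W k" using sol(1) n(3) by (simp add: tail_sum_Suc n_def)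
    moreover have "P j (xbar n) = u j" if j: "j \<in> {n..m}" for j
    proof (cases "j = n")
      case False
      with j have j: "j \<in> {Suc n..m}" "j \<in> {1..m}" "U j \<subseteq> W n"
        using n U_subset_W[of j n] by auto
      have Wn: "closed_subspace (W n)" using n by (simp add: closed_subspace_W)
      \<comment> \<open>As \<open>U\<^sub>j \<subseteq> W\<^sub>n\<close>, the projection on \<open>U\<^sub>j\<close> depends only on the one on \<open>W\<^sub>n\<close>.\<close>
      have "P j (xbar n) = P j (xbar (Suc n))"
      proof (rule closed_subspace.proj_eqI[OF closed_subspace_U[OF j(2)]])
        show "P j (xbar (Suc n)) \<in> U j"
          by (rule closed_subspace.proj_mem[OF closed_subspace_U[OF j(2)]])
        fix y assume y: "y \<in> U j"
        have "inner (xbar (Suc n)) y = inner (xbar n) y"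
          using closed_subspace.inner_proj[OF Wn, of y "xbar n"] y j(3) sol(3) by auto
        then show "inner (xbar n - P j (xbar (Suc n))) y = 0"
          using closed_subspace.inner_proj[OF closed_subspace_U[OF j(2)] y]
          by (simp add: inner_diff_left)
      qed
      then show ?thesis using IH(2) j(1) by simp
    qed (use sol(2) in simp)
    ultimately show ?case by (simp add: n_def)
  qed
qed

text \<open>
  Two solutions of the constraints on \<open>U\<^sub>i\<^sub>+\<^sub>1, \<dots>, U\<^sub>m\<close> differ by a vector orthogonal to each of these
  subspaces, hence to their sum; by Pythagoras a solution that lies in the sum is the strictly
  shortest one.
\<close>

lemma norm_less_of_mem_tail:
  assumes x: "x \<in> W i" "\<And>j. j \<in> {Suc i..m} \<Longrightarrow> P j x = u j"
    and y: "\<And>j. j \<in> {Suc i..m} \<Longrightarrow> P j y = u j" "y \<noteq> x"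
  shows "norm x < norm y"
proof -
  have "inner (y - x) x = 0"
  proof (rule orth_tail_sum[OF _ x(1)])
    fix j z assume j: "j \<in> {i + 1..m}" and z: "z \<in> U j"
    interpret j: closed_subspace "U j" using j by (intro closed_subspace_U) auto
    show "inner (y - x) z = 0"
      using j.inner_proj[OF z, of x] j.inner_proj[OF z, of y] x(2)[of j] y(1)[of j] j
      by (simp add: inner_diff_left)
  qed
  then have "(norm y)\<^sup>2 = (norm x)\<^sup>2 + (norm (y - x))\<^sup>2"
    by (simp add: power2_norm_eq_inner inner_diff_left inner_diff_right inner_commute)
  moreover have "(norm (y - x))\<^sup>2 > 0" using y(2) by simp
  ultimately have "(norm x)\<^sup>2 < (norm y)\<^sup>2" by linarith
  then show ?thesis by (rule power2_less_imp_less) simp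
qed

lemma sol_set_eq:
  assumes "\<And>i. i \<in> {1..m} \<Longrightarrow> u i \<in> U i" and "i \<in> {1..m}"
  shows "sol_set inner m U u i = {x. \<forall>j\<in>{i..m}. P j x = u j}"
proof -
  have "x \<in> u j +o orth_compl inner (U j) \<longleftrightarrow> P j x = u j" if "j \<in> {i..m}" for x j
  proof -
    have j: "j \<in> {1..m}" using that assms(2) by auto
    have "x \<in> u j +o orth_compl inner (U j) \<longleftrightarrow> x - u j \<in> orth_compl inner (U j)"
      by (metis set_minus_plus)
    then show ?thesis
      using closed_subspace.proj_eq_iff[OF closed_subspace_U[OF j] assms(1)[OF j]]
      by (simp add: orth_compl_def)
  qed
  then show ?thesis by (auto simp: sol_set_def)
qed

end

section \<open>From the scalar field to the reals\<close>

text \<open>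
  A vector \<open>x\<close> that is orthogonal to a subspace for the real part of \<open>ip\<close> is orthogonal to it for
  \<open>ip\<close> itself: the subspace contains with \<open>y\<close> also the multiple of \<open>y\<close> by the scalar \<open>ip x y\<close>,
  which turns \<open>ip x y\<close> into its squared modulus. So complements and projectors are the same for
  \<open>ip\<close> and for the underlying real inner product.
\<close>

context hilbert_space
begin

lemma ip_eq_0_imp_inner_eq_0:
  assumes "ip x y = 0"
  shows "inner x y = 0"
proof -
  have "sc_cnj (0 :: 'k) = 0" using sc_cnj_add[of "0::'k" 0] by simp
  then have "sc_re (0 :: 'k) = 0" using sc_add_cnj[of "0::'k"] by simp
  with assms show ?thesis by (simp add: inner_eq_re_ip)
qed

lemma inner_scale_ip: "inner (scale (ip x y) y) x = (norm (ip x y))\<^sup>2"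
proof -
  define z where "z = ip x y"
  \<comment> \<open>\<open>sc_re\<close> is determined by the sum with the conjugate; a self-conjugate number is its own real part.\<close>
  have cnj: "sc_cnj (z * sc_cnj z) = z * sc_cnj z"
    by (simp only: sc_cnj_mult sc_cnj_cnj mult.commute)
  have "(2 * sc_re (z * sc_cnj z)) *\<^sub>R (1::'k) = (2 * (norm z)\<^sup>2) *\<^sub>R 1"
  proof -
    have "(2 * sc_re (z * sc_cnj z)) *\<^sub>R (1::'k) = z * sc_cnj z + z * sc_cnj z"
      using sc_add_cnj[of "z * sc_cnj z"] unfolding cnj by (rule sym)
    also have "\<dots> = (2 * (norm z)\<^sup>2) *\<^sub>R 1"
      by (simp only: sc_mult_cnj flip: scaleR_add_left) simp
    finally show ?thesis .
  qed
  then have "sc_re (z * sc_cnj z) = (norm z)\<^sup>2"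
    by (simp only: scaleR_cancel_right) simp
  moreover have "ip (scale z y) x = z * sc_cnj z"
    by (simp only: ip_scale_left ip_cnj[of y x] z_def)
  ultimately show ?thesis by (simp add: inner_eq_re_ip z_def)
qed

lemma orth_compl_eq_real:
  assumes "subspace U"
  shows "orth_compl ip U = orth_compl inner U"
proof -
  have "ip x y = 0" if orth: "\<forall>y\<in>U. inner x y = 0" and y: "y \<in> U" for x y
  proof -
    have "inner x (scale (ip x y) y) = 0"
      using orth subspace_scale[OF assms y] by blast
    then show ?thesis using inner_scale_ip[of x y] by (simp add: inner_commute)
  qed
  then show ?thesis
    unfolding orth_compl_def using ip_eq_0_imp_inner_eq_0 by blast
qed

lemma orth_proj_eq_real: "subspace U \<Longrightarrow> orth_proj ip U = orth_proj inner U"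
  unfolding orth_proj_def by (simp add: orth_compl_eq_real)

lemma closed_subspace_real:
  assumes "subspace U" "closed U"
  shows "closed_subspace U"
proof
  show "real_vector.subspace U"
    unfolding real_vector.subspace_def scaleR_eq_scale
    using assms(1) by (simp add: subspace_def)
qed (fact assms(2))

end

theorem proposition3p1:
  fixes scale :: "'k::real_or_complex \<Rightarrow> 'a::{real_inner,complete_space} \<Rightarrow> 'a"
    and ip :: "'a \<Rightarrow> 'a \<Rightarrow> 'k"
    and m :: nat
    and U :: "nat \<Rightarrow> 'a set"
    and u xbar :: "nat \<Rightarrow> 'a"
  assumes "hilbert_space scale ip"
    and "m \<ge> 1"
    and "\<And>i. i \<in> {1..m} \<Longrightarrow> module.subspace scale (U i) \<and> closed (U i)"
    and "IBAP ip m U"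
    and "\<And>i. i \<in> {1..m} \<Longrightarrow> u i \<in> U i"
    and "xbar m = u m"
    and "\<And>i. i \<in> {1..<m} \<Longrightarrow> xbar i = op_T ip m U u i (xbar (i + 1))"
  shows
    "(\<forall>i\<in>{1..<m}. bij (op_A ip m U i) \<and> bij (op_B ip m U i) \<and>
        op_T ip m U u i \<in> tail_sum m U i \<rightarrow> U i + tail_sum m U i \<and>
        xbar (i + 1) \<in> tail_sum m U i) \<and>
     (\<forall>i\<in>{1..m}. sol_set ip m U u i \<noteq> {} \<and> xbar i = proj_onto (sol_set ip m U u i) 0) \<and>
     (let C = {x. \<forall>i\<in>{1..m}. orth_proj ip (U i) x = u i} in
        xbar 1 \<in> C \<and> (\<forall>y\<in>C. y \<noteq> xbar 1 \<longrightarrow> norm (xbar 1) < norm y))"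
proof -
  interpret H: hilbert_space scale ip by (fact assms(1))
  have sub: "H.subspace (U i)" if "i \<in> {1..m}" for i
    using assms(3)[OF that] by simp
  have P_eq: "orth_proj ip (U i) = orth_proj inner (U i)" if "i \<in> {1..m}" for i
    using H.orth_proj_eq_real[OF sub[OF that]] .
  interpret R: ibap_family m U
  proof (rule ibap_family.intro)
    show "closed_subspace (U i)" if "i \<in> {1..m}" for i
      using H.closed_subspace_real assms(3)[OF that] by blast
    show "IBAP inner m U"
      using assms(4) P_eq by (simp add: IBAP_def)
  qed
  note u = assms(5)
  have tp: "tail_proj ip m U i = tail_proj inner m U i" if "i \<in> {1..m}" for i
  proof -
    have "H.subspace (tail_sum m U i)" by (rule H.subspace_tail_sum[OF sub])
    then show ?thesis
      using that by (simp add: tail_proj_def R.closure_W H.orth_proj_eq_real)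
  qed
  have A: "op_A ip m U i = op_A inner m U i" and B: "op_B ip m U i = op_B inner m U i"
    if "i \<in> {1..m}" for i
    by (simp_all add: fun_eq_iff op_A_def op_B_def tp[OF that] P_eq[OF that])
  have T: "op_T ip m U u i = op_T inner m U u i" if "i \<in> {1..m}" for i
    by (simp add: fun_eq_iff op_T_def tp[OF that] P_eq[OF that] A[OF that] B[OF that])
  have S: "sol_set ip m U u i = {x. \<forall>j\<in>{i..m}. orth_proj inner (U j) x = u j}"
    if i: "i \<in> {1..m}" for i
  proof -
    have "sol_set ip m U u i = sol_set inner m U u i"
      using i sub by (simp add: sol_set_def H.orth_compl_eq_real)
    then show ?thesis using R.sol_set_eq[OF u i] by simp
  qed
  have rec: "xbar i = op_T inner m U u i (xbar (i + 1))" if "i \<in> {1..<m}" for i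
    using assms(7)[OF that] T[of i] that by simp
  have sol: "xbar (Suc i) \<in> tail_sum m U i \<and>
      (\<forall>j\<in>{Suc i..m}. orth_proj inner (U j) (xbar (Suc i)) = u j)" if "i < m" for i
    by (rule R.backward_solution[OF u assms(6) rec that])
  have min: "xbar i \<in> sol_set ip m U u i \<and>
      (\<forall>y\<in>sol_set ip m U u i. y \<noteq> xbar i \<longrightarrow> norm (xbar i) < norm y)"
    if i: "i \<in> {1..m}" for i
  proof -
    obtain k where k: "i = Suc k" "k < m" using i by (cases i) auto
    have x: "xbar i \<in> tail_sum m U k" "\<And>j. j \<in> {Suc k..m} \<Longrightarrow> orth_proj inner (U j) (xbar i) = u j"
      using sol[OF k(2)] by (auto simp: k(1))
    show ?thesis
      unfolding S[OF i] using x R.norm_less_of_mem_tail[OF x] by (auto simp: k(1))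
  qed
  have proj: "xbar i = proj_onto (sol_set ip m U u i) 0" if i: "i \<in> {1..m}" for i
    unfolding proj_onto_def
  proof (rule the_equality[symmetric])
    show "xbar i \<in> sol_set ip m U u i \<and> (\<forall>y\<in>sol_set ip m U u i. dist 0 (xbar i) \<le> dist 0 y)"
      using min[OF i] by (metis dist_0_norm less_eq_real_def)
    fix p assume "p \<in> sol_set ip m U u i \<and> (\<forall>y\<in>sol_set ip m U u i. dist 0 p \<le> dist 0 y)"
    then show "p = xbar i"
      using min[OF i] by (metis dist_0_norm not_less)
  qed
  have C: "{x. \<forall>i\<in>{1..m}. orth_proj ip (U i) x = u i} = sol_set ip m U u 1"
    using assms(2) P_eq by (subst S) auto
  show ?thesis
    unfolding C Let_def
  proof (intro conjI ballI)
    fix i assume i: "i \<in> {1..<m}"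
    then have i': "i \<in> {1..m}" by simp
    show "bij (op_A ip m U i)" "bij (op_B ip m U i)"
      unfolding A[OF i'] B[OF i'] by (rule R.bij_op_A_op_B[OF i'])+
    show "op_T ip m U u i \<in> tail_sum m U i \<rightarrow> U i + tail_sum m U i"
      unfolding T[OF i'] using R.op_T_solution(1)[where u = u, OF i' u[OF i']] by blast
    show "xbar (i + 1) \<in> tail_sum m U i"
      using sol[of i] i by simp
  next
    fix i assume i: "i \<in> {1..m}"
    show "sol_set ip m U u i \<noteq> {}" using min[OF i] by blast
    show "xbar i = proj_onto (sol_set ip m U u i) 0" by (rule proj[OF i])
  next
    show "xbar 1 \<in> sol_set ip m U u 1" using min[of 1] assms(2) by simp
    show "y \<noteq> xbar 1 \<longrightarrow> norm (xbar 1) < norm y" if "y \<in> sol_set ip m U u 1" for y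
      using min[of 1] assms(2) that by simp
  qed
qed

end
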